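(* Let $n\geq1$ and let $(M_j,\mathcal{F}_j)_{j=0}^n$ be a martingale such that $M_0=0$ and $|M_j-M_{j-1}|\leq1$ for all $1\leq j\leq n$. Define $$V_n:=\sum_{j=1}^n\mathbb{E}\left[(M_j-M_{j-1})^2\mid\mathcal{F}_{j-1}\right].$$ Then for any $t\geq1$ and any $v\geq0$, $$\mathbb{P}\left(M_n\geq\sqrt{2tv}+\frac{2t}{3},\ V_n\leq v\right)\leq e^{-t}\,\mathbb{P}(V_n>0),$$ and, for any $t\geq1$, $$\mathbb{P}\left(M_n\geq2\sqrt{V_n\,t}+t\right)\leq\left[7+\log_2n\right]e^{-t}\,\mathbb{P}(V_n>0).$$
   Context: $\log_2$ is the base-2 logarithm; $[7+\log_2 n]$ is just the number $7+\log_2 n$. *)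

theory Defs
  imports "HOL-Probability.Probability"
begin

text \<open>
  Only the indices \<open>0, \<dots>, n\<close> matter. Each \<open>F j\<close> is used solely through its space and its
  sigma-algebra; its own measure is irrelevant (in particular for \<^const>\<open>real_cond_exp\<close>).
\<close>

definition filtration_upto :: "'a measure \<Rightarrow> nat \<Rightarrow> (nat \<Rightarrow> 'a measure) \<Rightarrow> bool" where
  "filtration_upto P n F \<longleftrightarrow>
     (\<forall>j\<le>n. subalgebra P (F j)) \<and>
     (\<forall>i j. i \<le> j \<longrightarrow> j \<le> n \<longrightarrow> subalgebra (F j) (F i))"

definition martingale_upto ::
  "'a measure \<Rightarrow> nat \<Rightarrow> (nat \<Rightarrow> 'a measure) \<Rightarrow> (nat \<Rightarrow> 'a \<Rightarrow> real) \<Rightarrow> bool" where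
  "martingale_upto P n F M \<longleftrightarrow>
     filtration_upto P n F \<and>
     (\<forall>j\<le>n. M j \<in> borel_measurable (F j)) \<and>
     (\<forall>j\<le>n. integrable P (M j)) \<and>
     (\<forall>i j. i \<le> j \<longrightarrow> j \<le> n \<longrightarrow> (AE \<omega> in P. real_cond_exp P (F i) (M j) \<omega> = M i \<omega>))"

definition cond_variance_sum ::
  "'a measure \<Rightarrow> (nat \<Rightarrow> 'a measure) \<Rightarrow> (nat \<Rightarrow> 'a \<Rightarrow> real) \<Rightarrow> nat \<Rightarrow> 'a \<Rightarrow> real" where
  "cond_variance_sum P F M n \<omega> =
     (\<Sum>j=1..n. real_cond_exp P (F (j - 1)) (\<lambda>\<omega>'. (M j \<omega>' - M (j - 1) \<omega>')\<^sup>2) \<omega>)"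

end

theory Submission
  imports Defs
begin

text \<open>
  With \<open>c = \<lambda>\<^sup>2 / (2 (1 - \<lambda> / 3))\<close>, the process \<open>Z\<^sub>j = exp (\<lambda> M\<^sub>j - c V\<^sub>j)\<close> is a supermartingale, so
  \<open>E Z\<^sub>n \<le> 1\<close>. On \<open>V\<^sub>n = 0\<close> all increments vanish almost surely, hence \<open>Z\<^sub>n = 1\<close> there, and so
  \<open>E [Z\<^sub>n; V\<^sub>n > 0] \<le> P(V\<^sub>n > 0)\<close>. Markov's inequality on \<open>V\<^sub>n > 0\<close> with \<open>\<lambda> = x / (v + x / 3)\<close> gives
  Freedman's inequality with the extra factor. The self-normalized bound follows by applying it
  on the dyadic slices \<open>n / 2\<^bsup>k+1\<^esup> < V\<^sub>n \<le> n / 2\<^bsup>k\<^esup>\<close> and on the bottom slice \<open>V\<^sub>n \<le> 1 / 18\<close>.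
\<close>

section \<open>A Bernstein-type bound for the exponential function\<close>

lemma two_power_three_le_fact: "2 * 3 ^ k \<le> (fact (k + 2) :: real)"
proof (induction k)
  case (Suc k)
  have "2 * 3 ^ Suc k = 3 * (2 * 3 ^ k :: real)" by simp
  also have "\<dots> \<le> (real k + 3) * fact (k + 2)"
    by (intro mult_mono Suc) auto
  also have "\<dots> = fact (Suc k + 2)" by (simp add: algebra_simps)
  finally show ?case .
qed simp

text \<open>From the quadratic term on, the exponential series is dominated termwise by a geometric
  series of ratio \<open>l / 3\<close>, because each of the last \<open>k\<close> factors of
  \<open>(k + 2)!\<close> is at least 3. The linear term is kept exact so that the martingale
  property can cancel it later.\<close>

lemma exp_le_bernstein:
  fixes y l :: real
  assumes "\<bar>y\<bar> \<le> l" "l < 3"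
  shows "exp y \<le> 1 + y + y\<^sup>2 / (2 * (1 - l / 3))"
proof -
  have l: "\<bar>l / 3\<bar> < 1" using assms by auto
  have s: "summable (\<lambda>k. y\<^sup>2 / 2 * (l / 3) ^ k)"
    using l by (intro summable_mult summable_geometric) auto
  have t: "summable (\<lambda>k. inverse (fact (k + 2)) *\<^sub>R y ^ (k + 2))"
    using summable_exp_generic[of y] by (subst summable_iff_shift) (simp add: divide_inverse_commute)
  have le: "inverse (fact (k + 2)) *\<^sub>R y ^ (k + 2) \<le> y\<^sup>2 / 2 * (l / 3) ^ k" for k
  proof -
    have "inverse (fact (k + 2)) *\<^sub>R y ^ (k + 2) \<le> inverse (fact (k + 2)) * \<bar>y\<bar> ^ (k + 2)"
      unfolding power_abs[symmetric] real_scaleR_def by (intro mult_left_mono abs_ge_self) simp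
    also have "\<dots> \<le> inverse (2 * 3 ^ k) * (y\<^sup>2 * l ^ k)"
    proof (intro mult_mono)
      show "inverse (fact (k + 2)) \<le> inverse (2 * 3 ^ k :: real)"
        using two_power_three_le_fact[of k] by (intro le_imp_inverse_le) auto
      show "\<bar>y\<bar> ^ (k + 2) \<le> y\<^sup>2 * l ^ k"
        unfolding power_add power2_abs mult.commute[of "y\<^sup>2"] using assms
        by (intro mult_right_mono power_mono) auto
    qed auto
    also have "\<dots> = y\<^sup>2 / 2 * (l / 3) ^ k" by (simp add: field_simps)
    finally show ?thesis .
  qed
  have "exp y \<le> 1 + y + (\<Sum>k. y\<^sup>2 / 2 * (l / 3) ^ k)"
    unfolding exp_first_two_terms[of y] using suminf_le[OF le t s] by simp
  also have "(\<Sum>k. y\<^sup>2 / 2 * (l / 3) ^ k) = y\<^sup>2 / 2 * (1 / (1 - l / 3))"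
    using l by (subst suminf_mult) (auto simp: suminf_geometric intro: summable_geometric)
  finally show ?thesis by simp
qed

section \<open>Martingales with bounded steps: measurability and integrability\<close>

locale unit_step_martingale = prob_space P for P :: "'a measure" +
  fixes F :: "nat \<Rightarrow> 'a measure" and M :: "nat \<Rightarrow> 'a \<Rightarrow> real" and n :: nat
  assumes martingale: "martingale_upto P n F M"
    and start: "AE \<omega> in P. M 0 \<omega> = 0"
    and step_le_1: "\<And>j. j < n \<Longrightarrow> AE \<omega> in P. \<bar>M (Suc j) \<omega> - M j \<omega>\<bar> \<le> 1"
begin

abbreviation V :: "nat \<Rightarrow> 'a \<Rightarrow> real" where
  "V \<equiv> cond_variance_sum P F M"

abbreviation cond_var :: "nat \<Rightarrow> 'a \<Rightarrow> real" where
  "cond_var j \<equiv> real_cond_exp P (F j) (\<lambda>\<omega>. (M (Suc j) \<omega> - M j \<omega>)\<^sup>2)"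

text \<open>Indexing by the start of a step removes the truncated subtraction, so that passing from
  \<open>V j\<close> to \<open>V (Suc j)\<close> simply adds \<open>cond_var j\<close>.\<close>

lemma V_eq: "V k \<omega> = (\<Sum>j<k. cond_var j \<omega>)"
  unfolding cond_variance_sum_def
  by (rule sum.reindex_bij_witness[of _ Suc "\<lambda>j. j - 1"]) auto

lemma subalgebra_P: "j \<le> n \<Longrightarrow> subalgebra P (F j)"
  using martingale by (auto simp: martingale_upto_def filtration_upto_def)

lemma subalgebra_F: "i \<le> j \<Longrightarrow> j \<le> n \<Longrightarrow> subalgebra (F j) (F i)"
  using martingale by (auto simp: martingale_upto_def filtration_upto_def)

lemma sigma_finite_F: "j \<le> n \<Longrightarrow> sigma_finite_subalgebra P (F j)"
  by (intro finite_measure_subalgebra_is_sigma_finite finite_measure_subalgebra.intro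
      finite_measure_subalgebra_axioms.intro subalgebra_P) unfold_locales

lemma measurable_M_F: "i \<le> j \<Longrightarrow> j \<le> n \<Longrightarrow> M i \<in> borel_measurable (F j)"
  using martingale by (intro measurable_from_subalg[OF subalgebra_F, of i j]) (auto simp: martingale_upto_def)

lemma measurable_M [measurable]: "j \<le> n \<Longrightarrow> M j \<in> borel_measurable P"
  using measurable_M_F measurable_from_subalg[OF subalgebra_P] by blast

lemma integrable_M: "j \<le> n \<Longrightarrow> integrable P (M j)"
  using martingale by (auto simp: martingale_upto_def)

lemma cond_exp_M: "i \<le> j \<Longrightarrow> j \<le> n \<Longrightarrow> AE \<omega> in P. real_cond_exp P (F i) (M j) \<omega> = M i \<omega>"
  using martingale by (auto simp: martingale_upto_def)

text \<open>Predictability: \<open>V (Suc j)\<close> only involves conditional variances given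
  \<open>F 0\<close> up to \<open>F j\<close>. The bound \<open>Suc j\<close> instead of
  \<open>j\<close> is what later allows a weight containing \<open>V (Suc j)\<close> to be pulled
  out of a conditional expectation given \<open>F j\<close>.\<close>

lemma measurable_V_F: "i \<le> Suc j \<Longrightarrow> j \<le> n \<Longrightarrow> V i \<in> borel_measurable (F j)"
  unfolding V_eq
  by (intro borel_measurable_sum measurable_from_subalg[OF subalgebra_F borel_measurable_cond_exp])
     auto

lemma measurable_V [measurable]: "j \<le> n \<Longrightarrow> V j \<in> borel_measurable P"
  using measurable_V_F[of j j] measurable_from_subalg[OF subalgebra_P] by auto

section \<open>Almost sure bounds, and degeneracy where the variance vanishes\<close>

lemma integrable_step_sq: "j < n \<Longrightarrow> integrable P (\<lambda>\<omega>. (M (Suc j) \<omega> - M j \<omega>)\<^sup>2)"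
  using step_le_1[of j]
  by (intro integrable_const_bound[of _ 1]) (auto elim!: eventually_mono simp: abs_square_le_1)

lemma cond_var_nonneg: "j < n \<Longrightarrow> AE \<omega> in P. 0 \<le> cond_var j \<omega>"
  by (rule sigma_finite_subalgebra.real_cond_exp_pos[OF sigma_finite_F]) auto

lemma cond_var_le_1: "j < n \<Longrightarrow> AE \<omega> in P. cond_var j \<omega> \<le> 1"
  using step_le_1[of j]
  by (intro sigma_finite_subalgebra.real_cond_exp_le_c[OF sigma_finite_F] integrable_step_sq)
     (auto elim!: eventually_mono simp: abs_square_le_1)

lemma AE_cond_var_bounds: "AE \<omega> in P. \<forall>j<n. 0 \<le> cond_var j \<omega> \<and> cond_var j \<omega> \<le> 1"
proof -
  have "AE \<omega> in P. \<forall>j\<in>{..<n}. 0 \<le> cond_var j \<omega> \<and> cond_var j \<omega> \<le> 1"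
    using cond_var_nonneg cond_var_le_1 by (intro AE_finite_allI) auto
  thus ?thesis by eventually_elim auto
qed

lemma V_bounds: "k \<le> n \<Longrightarrow> AE \<omega> in P. 0 \<le> V k \<omega> \<and> V k \<omega> \<le> real k"
  using AE_cond_var_bounds
proof eventually_elim
  case (elim \<omega>)
  thus ?case
    using sum_mono[of "{..<k}" "\<lambda>j. cond_var j \<omega>" "\<lambda>_. 1"] by (auto simp: V_eq intro!: sum_nonneg)
qed

lemma M_bound: "k \<le> n \<Longrightarrow> AE \<omega> in P. \<bar>M k \<omega>\<bar> \<le> real k"
proof (induction k)
  case 0
  show ?case using start by eventually_elim auto
next
  case (Suc k)
  from Suc have "AE \<omega> in P. \<bar>M k \<omega>\<bar> \<le> real k" "AE \<omega> in P. \<bar>M (Suc k) \<omega> - M k \<omega>\<bar> \<le> 1"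
    using step_le_1[of k] by auto
  thus ?case by eventually_elim auto
qed

text \<open>The event \<open>cond_var j = 0\<close> lies in \<open>F j\<close>, so the squared step
  has the same integral over it as \<open>cond_var j\<close>, namely 0. A nonnegative function with
  zero integral vanishes almost everywhere.\<close>

lemma AE_step_zero:
  assumes "j < n"
  shows "AE \<omega> in P. cond_var j \<omega> = 0 \<longrightarrow> M (Suc j) \<omega> = M j \<omega>"
proof -
  interpret S: sigma_finite_subalgebra P "F j" using assms by (intro sigma_finite_F) auto
  have [measurable]: "M (Suc j) \<in> borel_measurable P" "M j \<in> borel_measurable P"
    using assms by auto
  let ?D = "\<lambda>\<omega>. (M (Suc j) \<omega> - M j \<omega>)\<^sup>2"
  let ?I = "\<lambda>\<omega>. if cond_var j \<omega> = 0 then 1 else 0 :: real"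
  have I: "?I \<in> borel_measurable (F j)" by measurable
  note [measurable] = measurable_from_subalg[OF S.subalg I]
  have int: "integrable P (\<lambda>\<omega>. ?I \<omega> * ?D \<omega>)"
    using integrable_step_sq[OF assms] by (rule Bochner_Integration.integrable_bound) auto
  have "(\<integral>\<omega>. ?I \<omega> * ?D \<omega> \<partial>P) = (\<integral>\<omega>. ?I \<omega> * cond_var j \<omega> \<partial>P)"
    using S.real_cond_exp_intg(2)[OF int I] by simp
  also have "(\<lambda>\<omega>. ?I \<omega> * cond_var j \<omega>) = (\<lambda>_. 0)" by auto
  finally have "AE \<omega> in P. ?I \<omega> * ?D \<omega> = 0"
    using integral_nonneg_eq_0_iff_AE[OF int] by auto
  thus ?thesis by eventually_elim (auto split: if_splits)
qed

text \<open>A sum of almost surely nonnegative terms that is at most 0 has only zero terms, so no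
  step moves the path away from its start at 0.\<close>

lemma AE_M_zero: "AE \<omega> in P. V n \<omega> \<le> 0 \<longrightarrow> M n \<omega> = 0"
proof -
  have "AE \<omega> in P. \<forall>j\<in>{..<n}. cond_var j \<omega> = 0 \<longrightarrow> M (Suc j) \<omega> = M j \<omega>"
    using AE_step_zero by (intro AE_finite_allI) auto
  thus ?thesis using AE_cond_var_bounds start
  proof eventually_elim
    case (elim \<omega>)
    show ?case
    proof
      assume "V n \<omega> \<le> 0"
      hence "(\<Sum>j<n. cond_var j \<omega>) = 0"
        using elim(2) by (intro antisym sum_nonneg) (auto simp: V_eq)
      hence "\<forall>j<n. cond_var j \<omega> = 0"
        using elim(2) by (subst (asm) sum_nonneg_eq_0_iff) auto
      hence "M (Suc j) \<omega> = M j \<omega>" if "j < n" for j using elim(1) that by auto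
      hence "k \<le> n \<Longrightarrow> M k \<omega> = 0" for k using elim(3) by (induction k) auto
      thus "M n \<omega> = 0" by simp
    qed
  qed
qed

section \<open>The exponential supermartingale and the resulting tail estimate\<close>

context
  fixes l c :: real
  assumes l: "0 \<le> l" "l < 3" and c: "c = l\<^sup>2 / (2 * (1 - l / 3))"
begin

text \<open>The constant \<open>c\<close> is the coefficient for which
  \<open>exp_le_bernstein\<close> gives \<open>exp (l * d) <= 1 + l * d + c * d^2\<close> whenever
  \<open>|d| <= 1\<close>; subtracting \<open>c * V\<close> compensates the quadratic term.\<close>

abbreviation Z :: "nat \<Rightarrow> 'a \<Rightarrow> real" where
  "Z j \<omega> \<equiv> exp (l * M j \<omega> - c * V j \<omega>)"

lemma c_nonneg: "0 \<le> c" using l unfolding c by simp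

lemma Z_bound:
  assumes "k \<le> n"
  shows "AE \<omega> in P. Z k \<omega> \<le> exp (l * real k)"
  using V_bounds[OF assms] M_bound[OF assms]
proof eventually_elim
  case (elim \<omega>)
  have "l * M k \<omega> \<le> l * real k" using elim l by (intro mult_left_mono) auto
  moreover have "0 \<le> c * V k \<omega>" using elim c_nonneg by simp
  ultimately show ?case by simp
qed

lemma integrable_Z: "k \<le> n \<Longrightarrow> integrable P (Z k)"
  using Z_bound[of k] by (intro integrable_const_bound[of _ "exp (l * real k)"]) auto

text \<open>The supermartingale step in integrated form: expand the exponential of the increment to
  second order, cancel the linear term, replace the squared step by its conditional variance, and
  absorb the result into the compensator.\<close>

lemma integral_Z_Suc_le:
  assumes j: "j < n"
  shows "(\<integral>\<omega>. Z (Suc j) \<omega> \<partial>P) \<le> (\<integral>\<omega>. Z j \<omega> \<partial>P)"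
proof -
  interpret S: sigma_finite_subalgebra P "F j" using j by (intro sigma_finite_F) auto
  have [measurable]: "M (Suc j) \<in> borel_measurable P" "M j \<in> borel_measurable P"
    "V (Suc j) \<in> borel_measurable P" "V j \<in> borel_measurable P"
    using j by auto
  let ?D = "\<lambda>\<omega>. M (Suc j) \<omega> - M j \<omega>"
  \<comment> \<open>This is \<open>Z (Suc j)\<close> with \<open>M\<close> frozen at time
    \<open>j\<close>. It is \<open>F j\<close>-measurable by predictability of \<open>V\<close>,
    hence can be moved in and out of conditional expectations given \<open>F j\<close>.\<close>
  let ?W = "\<lambda>\<omega>. exp (l * M j \<omega> - c * V (Suc j) \<omega>)"
  have W: "?W \<in> borel_measurable (F j)"
    using measurable_V_F[of "Suc j" j] measurable_M_F[of j j] j by simp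
  note [measurable] = measurable_from_subalg[OF S.subalg W]
  have V_Suc: "V (Suc j) \<omega> = V j \<omega> + cond_var j \<omega>" for \<omega> by (simp add: V_eq)
  have W_le: "AE \<omega> in P. ?W \<omega> \<le> exp (l * real j)"
    using Z_bound[of j, OF less_imp_le[OF j]] cond_var_nonneg[OF j]
  proof eventually_elim
    case (elim \<omega>)
    have "?W \<omega> \<le> Z j \<omega>"
      using mult_nonneg_nonneg[OF c_nonneg elim(2)] by (simp add: V_Suc algebra_simps)
    thus ?case using elim by linarith
  qed
  have int: "integrable P (\<lambda>\<omega>. ?W \<omega> * f \<omega>)" if "integrable P f" for f
  proof (rule Bochner_Integration.integrable_bound)
    show "integrable P (\<lambda>\<omega>. exp (l * real j) * f \<omega>)" using that by simp
    show "(\<lambda>\<omega>. ?W \<omega> * f \<omega>) \<in> borel_measurable P" using that by measurable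
    show "AE \<omega> in P. norm (?W \<omega> * f \<omega>) \<le> norm (exp (l * real j) * f \<omega>)"
      using W_le by eventually_elim (auto simp: abs_mult intro: mult_right_mono)
  qed
  have W_int: "integrable P ?W" using int[of "\<lambda>_. 1"] by simp
  note int_M = int[OF integrable_M]
  note int_sq = int[OF integrable_step_sq[OF j]]
  have int_D: "integrable P (\<lambda>\<omega>. ?W \<omega> * ?D \<omega>)"
    using j by (intro int Bochner_Integration.integrable_diff integrable_M) auto
  \<comment> \<open>The martingale property, tested against the \<open>F j\<close>-measurable
    weight, makes the linear term vanish.\<close>
  have "(\<integral>\<omega>. ?W \<omega> * M (Suc j) \<omega> \<partial>P) = (\<integral>\<omega>. ?W \<omega> * real_cond_exp P (F j) (M (Suc j)) \<omega> \<partial>P)"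
    using S.real_cond_exp_intg(2)[OF int_M W] j by simp
  also have "\<dots> = (\<integral>\<omega>. ?W \<omega> * M j \<omega> \<partial>P)"
  proof (rule integral_cong_AE)
    show "AE \<omega> in P. ?W \<omega> * real_cond_exp P (F j) (M (Suc j)) \<omega> = ?W \<omega> * M j \<omega>"
      using cond_exp_M[of j "Suc j"] j by (auto elim!: eventually_mono)
  qed auto
  finally have D_0: "(\<integral>\<omega>. ?W \<omega> * ?D \<omega> \<partial>P) = 0"
    using int_M[of "Suc j"] int_M[of j] j by (simp add: right_diff_distrib)
  have cv: "(\<integral>\<omega>. ?W \<omega> * (?D \<omega>)\<^sup>2 \<partial>P) = (\<integral>\<omega>. ?W \<omega> * cond_var j \<omega> \<partial>P)"
    using S.real_cond_exp_intg(2)[OF int_sq W] by simp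
  have int_cv: "integrable P (\<lambda>\<omega>. ?W \<omega> * cond_var j \<omega>)"
    using S.real_cond_exp_intg(1)[OF int_sq W] by simp
  have "(\<integral>\<omega>. Z (Suc j) \<omega> \<partial>P)
      \<le> (\<integral>\<omega>. ?W \<omega> + l * (?W \<omega> * ?D \<omega>) + c * (?W \<omega> * (?D \<omega>)\<^sup>2) \<partial>P)"
  proof (rule integral_mono_AE)
    show "AE \<omega> in P. Z (Suc j) \<omega> \<le> ?W \<omega> + l * (?W \<omega> * ?D \<omega>) + c * (?W \<omega> * (?D \<omega>)\<^sup>2)"
      using step_le_1[OF j]
    proof eventually_elim
      case (elim \<omega>)
      have "exp (l * ?D \<omega>) \<le> 1 + l * ?D \<omega> + (l * ?D \<omega>)\<^sup>2 / (2 * (1 - l / 3))"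
        using elim l mult_left_mono[of "\<bar>?D \<omega>\<bar>" 1 l]
        by (intro exp_le_bernstein) (auto simp: abs_mult)
      also have "\<dots> = 1 + l * ?D \<omega> + c * (?D \<omega>)\<^sup>2" by (simp add: c power_mult_distrib)
      finally have "?W \<omega> * exp (l * ?D \<omega>) \<le> ?W \<omega> * (1 + l * ?D \<omega> + c * (?D \<omega>)\<^sup>2)"
        by simp
      moreover have "?W \<omega> * exp (l * ?D \<omega>) = Z (Suc j) \<omega>"
        by (simp add: exp_add[symmetric] algebra_simps)
      ultimately show ?case by (simp add: algebra_simps)
    qed
  qed (use integrable_Z[of "Suc j"] W_int int_D int_sq j in auto)
  also have "\<dots> = (\<integral>\<omega>. ?W \<omega> \<partial>P) + c * (\<integral>\<omega>. ?W \<omega> * cond_var j \<omega> \<partial>P)"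
    using W_int int_D int_sq D_0 cv by simp
  also have "\<dots> = (\<integral>\<omega>. ?W \<omega> + c * (?W \<omega> * cond_var j \<omega>) \<partial>P)"
    using W_int int_cv by simp
  also have "\<dots> \<le> (\<integral>\<omega>. Z j \<omega> \<partial>P)"
  proof (rule integral_mono)
    fix \<omega>
    \<comment> \<open>The inequality \<open>1 + x <= exp x\<close> turns the variance term into
      exactly the factor by which \<open>Z j\<close> exceeds \<open>?W\<close>.\<close>
    have "?W \<omega> * (1 + c * cond_var j \<omega>) \<le> ?W \<omega> * exp (c * cond_var j \<omega>)"
      by (intro mult_left_mono exp_ge_add_one_self) simp
    also have "\<dots> = Z j \<omega>" by (simp add: V_Suc exp_add[symmetric] algebra_simps)
    finally show "?W \<omega> + c * (?W \<omega> * cond_var j \<omega>) \<le> Z j \<omega>" by (simp add: algebra_simps)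
  qed (use integrable_Z[of j] W_int int_cv j in auto)
  finally show ?thesis .
qed

lemma integral_Z_le_1: "k \<le> n \<Longrightarrow> (\<integral>\<omega>. Z k \<omega> \<partial>P) \<le> 1"
proof (induction k)
  case 0
  have "(\<integral>\<omega>. Z 0 \<omega> \<partial>P) = (\<integral>\<omega>. 1 \<partial>P)"
    using start by (intro integral_cong_AE) (auto elim!: eventually_mono simp: V_eq)
  thus ?case by (simp add: prob_space)
next
  case (Suc k)
  thus ?case using integral_Z_Suc_le[of k] by simp
qed

text \<open>Almost surely \<open>Z n = 1\<close> where \<open>V n = 0\<close>, so restricting to
  \<open>V n > 0\<close> removes exactly the probability of \<open>V n = 0\<close> from an
  expectation that is at most 1.\<close>

lemma integral_Z_pos_le:
  "(\<integral>\<omega>. Z n \<omega> * indicator {\<omega> \<in> space P. 0 < V n \<omega>} \<omega> \<partial>P) \<le> \<P>(\<omega> in P. V n \<omega> > 0)"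
proof -
  let ?A = "{\<omega> \<in> space P. 0 < V n \<omega>}"
  have [measurable]: "?A \<in> sets P" by measurable
  have int_A: "integrable P (indicator ?A :: 'a \<Rightarrow> real)"
    by (intro integrable_real_indicator) (simp_all add: emeasure_eq_measure)
  have "(\<integral>\<omega>. Z n \<omega> * indicator ?A \<omega> \<partial>P) = (\<integral>\<omega>. Z n \<omega> - 1 + indicator ?A \<omega> \<partial>P)"
  proof (rule integral_cong_AE)
    show "AE \<omega> in P. Z n \<omega> * indicator ?A \<omega> = Z n \<omega> - 1 + indicator ?A \<omega>"
      using AE_M_zero V_bounds[of n, OF order_refl] AE_space
    proof eventually_elim
      case (elim \<omega>)
      show ?case
      proof (cases "V n \<omega> > 0")
        case False
        hence "V n \<omega> = 0" using elim by simp
        thus ?thesis using elim by simp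
      qed (use elim in simp)
    qed
  qed auto
  also have "\<dots> = (\<integral>\<omega>. Z n \<omega> \<partial>P) - 1 + prob ?A"
    using integrable_Z[of n] int_A by (simp add: prob_space)
  finally show ?thesis using integral_Z_le_1[of n] by simp
qed

text \<open>Markov's inequality for \<open>Z n\<close> restricted to \<open>V n > 0\<close>.
  Positivity of \<open>x\<close> puts the event inside that set almost surely, since
  \<open>M n = 0\<close> wherever \<open>V n = 0\<close>.\<close>

lemma prob_le_exp:
  assumes "0 < x"
  shows "\<P>(\<omega> in P. M n \<omega> \<ge> x \<and> V n \<omega> \<le> v) \<le> exp (c * v - l * x) * \<P>(\<omega> in P. V n \<omega> > 0)"
proof -
  let ?A = "{\<omega> \<in> space P. 0 < V n \<omega>}" and ?E = "{\<omega> \<in> space P. M n \<omega> \<ge> x \<and> V n \<omega> \<le> v}"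
  have [measurable]: "?A \<in> sets P" "?E \<in> sets P" by measurable
  have "prob ?E = (\<integral>\<omega>. indicator ?E \<omega> \<partial>P)" by simp
  also have "\<dots> \<le> (\<integral>\<omega>. exp (c * v - l * x) * (Z n \<omega> * indicator ?A \<omega>) \<partial>P)"
  proof (rule integral_mono_AE)
    show "integrable P (indicator ?E :: 'a \<Rightarrow> real)"
      by (intro integrable_real_indicator) (simp_all add: emeasure_eq_measure)
    show "integrable P (\<lambda>\<omega>. exp (c * v - l * x) * (Z n \<omega> * indicator ?A \<omega>))"
      using integrable_Z[of n] by (intro integrable_mult_right integrable_real_mult_indicator) auto
    show "AE \<omega> in P. indicator ?E \<omega> \<le> exp (c * v - l * x) * (Z n \<omega> * indicator ?A \<omega>)"
      using AE_M_zero
    proof eventually_elim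
      case (elim \<omega>)
      show ?case
      proof (cases "\<omega> \<in> ?E")
        case True
        hence "V n \<omega> > 0" using elim assms by (cases "V n \<omega> \<le> 0") auto
        moreover have "c * V n \<omega> \<le> c * v" "l * x \<le> l * M n \<omega>"
          using True c_nonneg l by (auto intro: mult_left_mono)
        ultimately show ?thesis using True by (simp add: exp_add[symmetric])
      qed simp
    qed
  qed
  also have "\<dots> = exp (c * v - l * x) * (\<integral>\<omega>. Z n \<omega> * indicator ?A \<omega> \<partial>P)"
    by simp
  also have "\<dots> \<le> exp (c * v - l * x) * prob ?A"
    by (intro mult_left_mono integral_Z_pos_le) simp
  finally show ?thesis .
qed

end

section \<open>Freedman's inequality and its self-normalized form\<close>

theorem freedman_inequality:
  assumes t: "0 < t" and v: "0 \<le> v"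
  shows "\<P>(\<omega> in P. M n \<omega> \<ge> sqrt (2 * t * v) + 2 * t / 3 \<and> V n \<omega> \<le> v)
    \<le> exp (- t) * \<P>(\<omega> in P. V n \<omega> > 0)"
proof (cases "v = 0")
  case True
  \<comment> \<open>For \<open>v = 0\<close> the choice of \<open>l\<close> below would give the
    excluded value 3. Here the event is null: it forces \<open>M n = 0\<close>, while the threshold
    is positive.\<close>
  have "\<P>(\<omega> in P. M n \<omega> \<ge> sqrt (2 * t * v) + 2 * t / 3 \<and> V n \<omega> \<le> v) = 0"
    using AE_M_zero t True
    by (intro prob_eq_0_AE) (auto elim!: eventually_mono)
  thus ?thesis by simp
next
  case False
  hence v: "0 < v" using v by simp
  define s where "s = sqrt (2 * t * v)"
  define x where "x = s + 2 * t / 3"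
  \<comment> \<open>This choice gives \<open>1 - l / 3 = v / (v + x / 3)\<close>, so the exponent
    \<open>c * v - l * x\<close> collapses to Bernstein's
    \<open>- x^2 / (2 * (v + x / 3))\<close>.\<close>
  define l where "l = x / (v + x / 3)"
  define c where "c = l\<^sup>2 / (2 * (1 - l / 3))"
  have s: "0 \<le> s" "s\<^sup>2 = 2 * t * v" using t v by (auto simp: s_def)
  have x: "0 < x" using s t by (simp add: x_def)
  let ?b = "v + x / 3"
  have b: "0 < ?b" using v x by simp
  have l: "0 \<le> l" "l < 3" using v x by (auto simp: l_def field_simps)
  have lx: "l * ?b = x" using b by (simp add: l_def)
  have "1 - l / 3 = v / ?b" using b by (simp add: l_def field_simps)
  hence "c * v = l\<^sup>2 * ?b / 2" using v b by (simp add: c_def)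
  also have "\<dots> = l * x / 2" using lx by (simp add: power2_eq_square)
  finally have "c * v - l * x = - (l * x / 2)" by simp
  \<comment> \<open>The summand \<open>2 * t / 3\<close> of \<open>x\<close> makes the terms in
    \<open>t * v\<close> and \<open>t^2\<close> agree on both sides; the surplus on the right is
    \<open>2 * t * s / 3\<close>.\<close>
  moreover have "t * (2 * ?b) \<le> x\<^sup>2"
  proof -
    have "x\<^sup>2 = 2 * t * v + 4 * t / 3 * s + 4 * t\<^sup>2 / 9"
      unfolding x_def power2_sum s by (simp add: field_simps power2_eq_square)
    moreover have "t * (2 * ?b) = 2 * t * v + 2 * t / 3 * s + 4 * t\<^sup>2 / 9"
      unfolding x_def by (simp add: field_simps power2_eq_square)
    ultimately show ?thesis using mult_nonneg_nonneg[of t s] s t by simp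
  qed
  hence "t \<le> l * x / 2" using b by (simp add: l_def field_simps power2_eq_square)
  ultimately have "exp (c * v - l * x) \<le> exp (- t)" by simp
  hence "exp (c * v - l * x) * \<P>(\<omega> in P. V n \<omega> > 0) \<le> exp (- t) * \<P>(\<omega> in P. V n \<omega> > 0)"
    by (intro mult_right_mono) auto
  with prob_le_exp[OF l c_def x, of v] show ?thesis
    unfolding x_def s_def by linarith
qed

text \<open>A union bound over \<open>K + 1\<close> fixed variance levels, each contributing
  \<open>?q\<close>. When \<open>u / 2 < V n <= u\<close>, the random term
  \<open>2 * sqrt (V n * t)\<close> is at least \<open>sqrt (2 * t * u)\<close>; at the lowest level
  the spare \<open>t / 3\<close> between \<open>t\<close> and \<open>2 * t / 3\<close> replaces
  it.\<close>

theorem self_normalized_freedman_inequality: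
  assumes n: "1 \<le> n" and t: "1 \<le> t"
  shows "\<P>(\<omega> in P. M n \<omega> \<ge> 2 * sqrt (V n \<omega> * t) + t)
    \<le> (7 + log 2 (real n)) * exp (- t) * \<P>(\<omega> in P. V n \<omega> > 0)"
proof -
  \<comment> \<open>The factor 18 ensures \<open>u K <= 1 / 18\<close>, which makes
    \<open>sqrt (2 * t * u K)\<close> at most the spare \<open>t / 3\<close>.\<close>
  define K where "K = nat \<lceil>log 2 (18 * real n)\<rceil>"
  define u where "u k = real n / 2 ^ k" for k :: nat
  define E where "E v = {\<omega> \<in> space P. M n \<omega> \<ge> sqrt (2 * t * v) + 2 * t / 3 \<and> V n \<omega> \<le> v}" for v
  let ?A = "{\<omega> \<in> space P. M n \<omega> \<ge> 2 * sqrt (V n \<omega> * t) + t}"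
  let ?q = "exp (- t) * \<P>(\<omega> in P. V n \<omega> > 0)"
  have [measurable]: "E v \<in> sets P" for v unfolding E_def by measurable
  have u_pos: "0 < u k" for k using n by (simp add: u_def)
  have E_le: "prob (E v) \<le> ?q" if "0 \<le> v" for v
    using freedman_inequality[of t v] t that by (simp add: E_def)
  have log_pos: "0 \<le> log 2 (18 * real n)" using n by (subst zero_le_log_cancel_iff) auto
  hence "log 2 (18 * real n) \<le> real K" unfolding K_def by linarith
  hence "18 * real n \<le> 2 ^ K" using n by (simp add: log_le_iff powr_realpow)
  hence u_K: "u K \<le> 1 / 18" by (simp add: u_def field_simps)
  \<comment> \<open>The constant 7 is 5 for \<open>log 2 18\<close>, 1 for the rounding up, and 1
    for counting the levels from 0 to \<open>K\<close>.\<close>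
  have "log 2 (18 * real n) = log 2 18 + log 2 (real n)" using n by (simp add: log_mult)
  moreover have "log 2 18 \<le> (5 :: real)" by (subst log_le_iff) auto
  moreover have "real K < log 2 (18 * real n) + 1" using log_pos unfolding K_def by linarith
  ultimately have K: "real (Suc K) \<le> 7 + log 2 (real n)" by simp
  have "AE \<omega> in P. \<omega> \<in> ?A \<longrightarrow> \<omega> \<in> (\<Union>k\<le>K. E (u k))"
    using V_bounds[of n, OF order_refl] AE_space
  proof eventually_elim
    case (elim \<omega>)
    show ?case
    proof
      assume A: "\<omega> \<in> ?A"
      show "\<omega> \<in> (\<Union>k\<le>K. E (u k))"
      proof (cases "V n \<omega> \<le> u K")
        case True
        have "sqrt (2 * t * u K) \<le> sqrt ((t / 3)\<^sup>2)"
        proof (rule real_sqrt_le_mono)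
          have "2 * t * u K \<le> 2 * t * (1 / 18)" using u_K t by (intro mult_left_mono) auto
          \<comment> \<open>This compares \<open>t / 9\<close> with \<open>t^2 / 9\<close>, which is
            where \<open>t >= 1\<close> enters.\<close>
          also have "\<dots> \<le> (t / 3)\<^sup>2" using t by (simp add: power2_eq_square)
          finally show "2 * t * u K \<le> (t / 3)\<^sup>2" .
        qed
        hence "sqrt (2 * t * u K) \<le> t / 3" using t by simp
        moreover have "0 \<le> sqrt (V n \<omega> * t)" using elim t by simp
        moreover have "2 * sqrt (V n \<omega> * t) + t \<le> M n \<omega>" using A by simp
        ultimately have "sqrt (2 * t * u K) + 2 * t / 3 \<le> M n \<omega>" by linarith
        hence "\<omega> \<in> E (u K)" using A True by (simp add: E_def)
        thus ?thesis by auto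
      next
        case False
        \<comment> \<open>The least level below \<open>V n\<close> is not 0, as
          \<open>V n <= n = u 0\<close> almost surely. Its predecessor \<open>i\<close> therefore
          satisfies \<open>V n <= u i < 2 * V n\<close>.\<close>
        define k where "k = (LEAST k. u k < V n \<omega>)"
        have k: "u k < V n \<omega>" unfolding k_def by (rule LeastI[of _ K]) (use False in simp)
        have k_le: "k \<le> K" unfolding k_def by (rule Least_le) (use False in simp)
        have "k \<noteq> 0" using k elim by (cases "k = 0") (auto simp: u_def)
        then obtain i where i: "k = Suc i" by (cases k) auto
        have V_le: "V n \<omega> \<le> u i" using not_less_Least[of i "\<lambda>k. u k < V n \<omega>"] i
          by (simp add: k_def not_less)
        have "sqrt (2 * t * u i) \<le> sqrt (2\<^sup>2 * (V n \<omega> * t))"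
        proof (rule real_sqrt_le_mono)
          have "2 * t * u i \<le> 2 * t * (2 * V n \<omega>)"
            using k t by (intro mult_left_mono) (auto simp: i u_def)
          thus "2 * t * u i \<le> 2\<^sup>2 * (V n \<omega> * t)" by (simp add: mult_ac)
        qed
        hence "sqrt (2 * t * u i) \<le> 2 * sqrt (V n \<omega> * t)" by (simp add: real_sqrt_mult)
        hence "\<omega> \<in> E (u i)" using A V_le t by (simp add: E_def)
        thus ?thesis using k_le i by auto
      qed
    qed
  qed
  hence "prob ?A \<le> prob (\<Union>k\<le>K. E (u k))"
    by (intro finite_measure_mono_AE) auto
  also have "\<dots> \<le> (\<Sum>k\<le>K. prob (E (u k)))"
    by (intro finite_measure_subadditive_finite) auto
  also have "\<dots> \<le> (\<Sum>k\<le>K. ?q)"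
    by (intro sum_mono E_le less_imp_le u_pos)
  also have "\<dots> = real (Suc K) * ?q" by simp
  also have "\<dots> \<le> (7 + log 2 (real n)) * ?q" by (intro mult_right_mono K) simp
  finally show ?thesis by (simp add: mult.assoc)
qed

end

theorem lemma5:
  fixes P :: "'a measure" and F :: "nat \<Rightarrow> 'a measure"
    and M :: "nat \<Rightarrow> 'a \<Rightarrow> real" and n :: nat and V :: "'a \<Rightarrow> real"
  assumes "prob_space P"
    and "n \<ge> 1"
    and "martingale_upto P n F M"
    and "AE \<omega> in P. M 0 \<omega> = 0"
    and "\<And>j. 1 \<le> j \<Longrightarrow> j \<le> n \<Longrightarrow> AE \<omega> in P. \<bar>M j \<omega> - M (j - 1) \<omega>\<bar> \<le> 1"
  defines "V \<equiv> cond_variance_sum P F M n"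
  shows "(\<forall>t v :: real. t \<ge> 1 \<longrightarrow> v \<ge> 0 \<longrightarrow>
           \<P>(\<omega> in P. M n \<omega> \<ge> sqrt (2 * t * v) + 2 * t / 3 \<and> V \<omega> \<le> v)
             \<le> exp (- t) * \<P>(\<omega> in P. V \<omega> > 0)) \<and>
         (\<forall>t :: real. t \<ge> 1 \<longrightarrow>
           \<P>(\<omega> in P. M n \<omega> \<ge> 2 * sqrt (V \<omega> * t) + t)
             \<le> (7 + log 2 (real n)) * exp (- t) * \<P>(\<omega> in P. V \<omega> > 0))"
proof -
  \<comment> \<open>Taking the step bound at \<open>Suc j\<close> matches the indexing of steps by
    their start.\<close>
  interpret unit_step_martingale P F M n
    using assms(1,3,4) assms(5)[of "Suc _"]
    by (intro unit_step_martingale.intro unit_step_martingale_axioms.intro) auto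
  show ?thesis
    unfolding V_def using freedman_inequality self_normalized_freedman_inequality assms(2) by auto
qed

end
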